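(* Let $m\ge2$, $n\ge1$, $f_i:\mathbb{R}^n\to\mathbb{R}$ smooth, $F(\boldsymbol\theta)=\sum_{i=1}^mf_i(\boldsymbol\theta_i)$, $\mathbf{r}\in\mathbb{R}^n$, and let $\mathcal{G}$ be a connected undirected graph on $\{1,\dots,m\}$ with Laplacian $\mathbf{L}$. Let $\boldsymbol\theta^0\in\mathbb{R}^{mn}$ satisfy $(\mathbf{1}_m^\top\otimes\mathbf{I}_n)\boldsymbol\theta^0=\mathbf{r}$ and $\Psi_{\boldsymbol\theta^0}(\mathbf{x})=F(\boldsymbol\theta^0+\sqrt{\hat{\mathbf{L}}}\mathbf{x})$. Let $\epsilon,\gamma$ be given and suppose $\mathbf{x}\in\mathbb{R}^{mn}$ satisfies: (i) $\|\nabla\Psi_{\boldsymbol\theta^0}(\mathbf{x})\|\le\epsilon$; (ii) $(\mathbf{1}_m^\top\otimes\mathbf{I}_n)\mathbf{x}=\mathbf{0}$; (iii) $\lambda_{\min}(\nabla^2\Psi_{\boldsymbol\theta^0}(\mathbf{x}))\ge-\gamma$. Then $\boldsymbol\theta=\boldsymbol\theta^0+\sqrt{\hat{\mathbf{L}}}\mathbf{x}$ is an $(\epsilon,\gamma/\lambda^+_{\min}(\mathbf{L}))$-second-order optimal solution.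
   Context: $\boldsymbol\theta=[\boldsymbol\theta_1^\top,\dots,\boldsymbol\theta_m^\top]^\top\in\mathbb{R}^{mn}$. $\sqrt{\mathbf{L}}$ is the unique symmetric positive semidefinite square root of $\mathbf{L}$; $\hat{\mathbf{L}}=\mathbf{L}\otimes\mathbf{I}_n$, $\sqrt{\hat{\mathbf{L}}}=\sqrt{\mathbf{L}}\otimes\mathbf{I}_n$; $\lambda^+_{\min}(\mathbf{L})$ is the smallest nonzero eigenvalue of $\mathbf{L}$. A point $\boldsymbol\theta\in\mathbb{R}^{mn}$ is an $(\epsilon,\gamma)$-second-order optimal solution of $\min F(\boldsymbol\theta)$ s.t. $\sum_i\boldsymbol\theta_i=\mathbf{r}$ if: (i) $\|\sqrt{\hat{\mathbf{L}}}\nabla F(\boldsymbol\theta)\|\le\epsilon$; (ii) $(\mathbf{1}_m^\top\otimes\mathbf{I}_n)\boldsymbol\theta=\mathbf{r}$; (iii) $\mathbf{d}^\top\nabla^2F(\boldsymbol\theta)\mathbf{d}\ge-\gamma\|\mathbf{d}\|^2$ for all $\mathbf{d}\in\mathcal{T}=\{\mathbf{d}\in\mathbb{R}^{mn}:(\mathbf{1}_m^\top\otimes\mathbf{I}_n)\mathbf{d}=\mathbf{0}\}$. *)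

theory Defs
  imports "HOL-Analysis.Analysis"
begin

text \<open>Vectors in R^(mn) are represented as block vectors of type real^'n^'m:
  theta $ i is the i-th block theta_i in R^n.  Node set {1..m} is the finite type 'm.\<close>

text \<open>C-infinity smoothness: every iterated partial derivative exists (Frechet-differentiable everywhere).\<close>
definition smooth_fun :: "('a::euclidean_space \<Rightarrow> real) \<Rightarrow> bool" where
  "smooth_fun f \<longleftrightarrow> (\<exists>S. f \<in> S \<and>
     (\<forall>g\<in>S. (\<forall>x. g differentiable (at x)) \<and>
             (\<forall>b\<in>Basis. (\<lambda>x. frechet_derivative g (at x) b) \<in> S)))"

text \<open>Gradient and Hessian (as a linear operator).\<close>
definition grad :: "('a::real_inner \<Rightarrow> real) \<Rightarrow> 'a \<Rightarrow> 'a" where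
  "grad F x = (SOME g. (F has_derivative (\<lambda>h. g \<bullet> h)) (at x))"

definition hess :: "('a::real_inner \<Rightarrow> real) \<Rightarrow> 'a \<Rightarrow> 'a \<Rightarrow> 'a" where
  "hess F x = frechet_derivative (grad F) (at x)"

text \<open>Smallest eigenvalue of a linear operator.\<close>
definition lambda_min :: "('a::real_vector \<Rightarrow> 'a) \<Rightarrow> real" where
  "lambda_min H = Min {c. \<exists>v. v \<noteq> 0 \<and> H v = c *\<^sub>R v}"

text \<open>Smallest nonzero eigenvalue of a square matrix.\<close>
definition lambda_min_pos :: "real^'m^'m \<Rightarrow> real" where
  "lambda_min_pos L = Min {c. c \<noteq> 0 \<and> (\<exists>v. v \<noteq> 0 \<and> L *v v = c *\<^sub>R v)}"

text \<open>Undirected connected graph on 'm given by an edge relation; its Laplacian.\<close>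
definition connected_graph :: "('m \<Rightarrow> 'm \<Rightarrow> bool) \<Rightarrow> bool" where
  "connected_graph E \<longleftrightarrow> (\<forall>i j. E i j \<longrightarrow> E j i) \<and> (\<forall>i. \<not> E i i) \<and> (\<forall>i j. E\<^sup>*\<^sup>* i j)"

definition laplacian :: "('m::finite \<Rightarrow> 'm \<Rightarrow> bool) \<Rightarrow> real^'m^'m" where
  "laplacian E = (\<chi> i j. if i = j then real (card {k. E i k}) else if E i j then -1 else 0)"

text \<open>The unique symmetric positive semidefinite square root.\<close>
definition psd_sqrt :: "real^'m^'m \<Rightarrow> real^'m^'m" where
  "psd_sqrt L = (THE S. transpose S = S \<and> (\<forall>x. 0 \<le> x \<bullet> (S *v x)) \<and> S ** S = L)"

text \<open>Action of (A \<otimes> I_n) on a block vector.\<close>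
definition kron_I :: "real^'m^'m \<Rightarrow> real^'n^'m \<Rightarrow> real^'n^'m" where
  "kron_I A x = (\<chi> i. \<Sum>j\<in>UNIV. A $ i $ j *\<^sub>R x $ j)"

text \<open>(1_m^T \<otimes> I_n) x\<close>
definition block_sum :: "real^'n^'m \<Rightarrow> real^'n" where
  "block_sum x = (\<Sum>i\<in>UNIV. x $ i)"

definition second_order_optimal ::
  "(real^'n^'m \<Rightarrow> real) \<Rightarrow> real^'n \<Rightarrow> real^'m^'m \<Rightarrow> real \<Rightarrow> real \<Rightarrow> real^'n^'m \<Rightarrow> bool" where
  "second_order_optimal F r L \<epsilon> \<gamma> \<theta> \<longleftrightarrow>
     norm (kron_I (psd_sqrt L) (grad F \<theta>)) \<le> \<epsilon> \<and>
     block_sum \<theta> = r \<and>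
     (\<forall>d. block_sum d = 0 \<longrightarrow> d \<bullet> hess F \<theta> d \<ge> - \<gamma> * (norm d)\<^sup>2)"

end

theory Submission
  imports Defs
begin

(*
  Put K = sqrt(L) (x) I_n.  K is symmetric, and since the kernel of the Laplacian of a connected
  graph consists of the constant vectors, the range of K is exactly the tangent space T of block
  vectors whose blocks sum to zero.  By the chain rule grad Psi(x) = K grad F(theta) and
  hess Psi(x) = K hess F(theta) K, so (i) is the hypothesis on grad Psi, and (ii) holds because
  K x lies in T.  For (iii), diagonalising L shows that every d in T is K y for some y with
  lambda_min^+(L) |y|^2 <= |d|^2, hence
    d' hess F(theta) d = y' hess Psi(x) y >= -gamma |y|^2 >= -(gamma / lambda_min^+(L)) |d|^2,
  where gamma >= 0 because the constant block vectors lie in the kernel of hess Psi(x).  Both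
  Hessians are symmetric by Schwarz's theorem, which is what makes lambda_min a lower bound for
  their quadratic forms.
*)

section \<open>Self-adjoint operators and orthonormal eigenbases\<close>

definition self_adjoint :: "('a::real_inner \<Rightarrow> 'a) \<Rightarrow> bool" where
  "self_adjoint A \<longleftrightarrow> (\<forall>u v. A u \<bullet> v = u \<bullet> A v)"

lemma self_adjoint_matrix_iff:
  fixes A :: "real^'m::finite^'m"
  shows "self_adjoint ((*v) A) \<longleftrightarrow> transpose A = A"
proof -
  have transpose_inner: "(transpose A *v u) \<bullet> v = u \<bullet> (A *v v)" for u v
    by (simp flip: dot_lmul_matrix)
  show ?thesis
  proof
    assume "self_adjoint ((*v) A)"
    then have "(A *v u) \<bullet> v = (transpose A *v u) \<bullet> v" for u v
      unfolding self_adjoint_def transpose_inner by blast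
    then have "A *v u = transpose A *v u" for u
      by (meson vector_eq_rdot)
    then show "transpose A = A"
      by (simp add: matrix_eq)
  next
    assume "transpose A = A"
    then show "self_adjoint ((*v) A)"
      unfolding self_adjoint_def using transpose_inner by metis
  qed
qed

definition orthonormal_basis :: "'a::real_inner set \<Rightarrow> bool" where
  "orthonormal_basis B \<longleftrightarrow> finite B \<and> pairwise orthogonal B \<and> (\<forall>b\<in>B. norm b = 1) \<and> span B = UNIV"

lemma orthonormal_basis_inner_eq:
  assumes "orthonormal_basis B" "b \<in> B" "c \<in> B"
  shows "b \<bullet> c = (if b = c then 1 else 0)"
  using assms unfolding orthonormal_basis_def pairwise_def orthogonal_def
  by (auto simp: dot_square_norm)

lemma orthonormal_basis_inner_sum:
  assumes "orthonormal_basis B" "b \<in> B"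
  shows "(\<Sum>c\<in>B. u c *\<^sub>R c) \<bullet> b = u b"
proof -
  have "(\<Sum>c\<in>B. u c *\<^sub>R c) \<bullet> b = (\<Sum>c\<in>B. if c = b then u b else 0)"
    unfolding inner_sum_left using assms by (intro sum.cong) (auto simp: orthonormal_basis_inner_eq)
  then show ?thesis
    using assms unfolding orthonormal_basis_def by simp
qed

lemma orthonormal_basis_expansion:
  assumes "orthonormal_basis B"
  shows "y = (\<Sum>b\<in>B. (y \<bullet> b) *\<^sub>R b)"
proof -
  have "finite B" "y \<in> span B" using assms unfolding orthonormal_basis_def by auto
  then obtain u where u: "y = (\<Sum>b\<in>B. u b *\<^sub>R b)" by (auto simp: span_finite)
  then have "y \<bullet> b = u b" if "b \<in> B" for b
    using orthonormal_basis_inner_sum[OF assms that] by simp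
  then show ?thesis using u by (metis (no_types, lifting) sum.cong)
qed

lemma orthonormal_basis_inner:
  assumes "orthonormal_basis B"
  shows "y \<bullet> z = (\<Sum>b\<in>B. (y \<bullet> b) * (z \<bullet> b))"
  by (subst orthonormal_basis_expansion[OF assms, of z]) (simp add: inner_sum_right mult.commute)

lemma orthonormal_basis_norm:
  assumes "orthonormal_basis B"
  shows "(norm y)\<^sup>2 = (\<Sum>b\<in>B. (y \<bullet> b)\<^sup>2)"
  unfolding power2_norm_eq_inner by (subst orthonormal_basis_inner[OF assms]) (simp add: power2_eq_square)

lemma orthonormal_basis_nonzero:
  assumes "orthonormal_basis B" "v \<noteq> 0"
  obtains b where "b \<in> B" "v \<bullet> b \<noteq> 0"
proof (rule ccontr)
  assume "\<not> thesis"
  with that have "\<forall>b\<in>B. v \<bullet> b = 0" by blast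
  then have "v = 0" by (subst orthonormal_basis_expansion[OF assms(1)]) simp
  with assms(2) show False ..
qed

definition diag_op :: "'a::real_inner set \<Rightarrow> ('a \<Rightarrow> real) \<Rightarrow> 'a \<Rightarrow> 'a" where
  "diag_op B \<mu> y = (\<Sum>b\<in>B. (\<mu> b * (y \<bullet> b)) *\<^sub>R b)"

lemma linear_diag_op: "linear (diag_op B \<mu>)"
  by (rule linearI)
    (simp_all add: diag_op_def inner_add_left distrib_left scaleR_add_left sum.distrib
      scaleR_sum_right mult.left_commute)

lemma self_adjoint_diag_op: "self_adjoint (diag_op B \<mu>)"
  unfolding self_adjoint_def diag_op_def
  by (simp add: inner_sum_left inner_sum_right inner_commute mult.left_commute mult.commute)

lemma inner_diag_op:
  assumes "orthonormal_basis B" "b \<in> B"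
  shows "diag_op B \<mu> y \<bullet> b = \<mu> b * (y \<bullet> b)"
  unfolding diag_op_def by (rule orthonormal_basis_inner_sum[OF assms])

lemma diag_op_diag_op:
  assumes "orthonormal_basis B"
  shows "diag_op B \<mu> (diag_op B \<nu> y) = diag_op B (\<lambda>b. \<mu> b * \<nu> b) y"
  unfolding diag_op_def[of B \<mu>] diag_op_def[of B "\<lambda>b. \<mu> b * \<nu> b"]
  by (intro sum.cong refl) (simp add: inner_diag_op[OF assms] mult.assoc)

lemma inner_diag_op_self:
  assumes "orthonormal_basis B"
  shows "y \<bullet> diag_op B \<mu> y = (\<Sum>b\<in>B. \<mu> b * (y \<bullet> b)\<^sup>2)"
  unfolding diag_op_def by (simp add: inner_sum_right power2_eq_square mult.assoc)

definition orthonormal_eigenbasis :: "('a::real_inner \<Rightarrow> 'a) \<Rightarrow> 'a set \<Rightarrow> bool" where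
  "orthonormal_eigenbasis A B \<longleftrightarrow> orthonormal_basis B \<and> (\<forall>b\<in>B. A b = (b \<bullet> A b) *\<^sub>R b)"

lemma orthonormal_eigenbasisD:
  assumes "orthonormal_eigenbasis A B"
  shows "orthonormal_basis B" and "b \<in> B \<Longrightarrow> b \<noteq> 0" and "b \<in> B \<Longrightarrow> A b = (b \<bullet> A b) *\<^sub>R b"
proof -
  show "orthonormal_basis B" "b \<in> B \<Longrightarrow> A b = (b \<bullet> A b) *\<^sub>R b"
    using assms unfolding orthonormal_eigenbasis_def by blast+
  show "b \<in> B \<Longrightarrow> b \<noteq> 0"
    using assms unfolding orthonormal_eigenbasis_def orthonormal_basis_def by (metis norm_zero zero_neq_one)
qed

lemma orthonormal_eigenbasis_diag_op:
  assumes "linear A" "orthonormal_eigenbasis A B"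
  shows "A = diag_op B (\<lambda>b. b \<bullet> A b)"
proof
  fix y
  note B = orthonormal_eigenbasisD(1)[OF assms(2)]
  have "A y = (\<Sum>b\<in>B. (y \<bullet> b) *\<^sub>R A b)"
    by (subst orthonormal_basis_expansion[OF B, of y]) (simp add: linear_sum[OF assms(1)] linear_scale[OF assms(1)])
  also have "\<dots> = diag_op B (\<lambda>b. b \<bullet> A b) y"
    unfolding diag_op_def using orthonormal_eigenbasisD(3)[OF assms(2)]
    by (intro sum.cong refl) (metis mult.commute scaleR_scaleR)
  finally show "A y = diag_op B (\<lambda>b. b \<bullet> A b) y" .
qed

section \<open>The spectral theorem for self-adjoint operators\<close>

lemma nonneg_quadratic_imp_linear_coeff_zero:
  fixes a b :: real
  assumes "\<And>t. 0 \<le> t * a + t\<^sup>2 * b"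
  shows "a = 0"
proof (rule ccontr)
  assume "a \<noteq> 0"
  define s where "s = \<bar>b\<bar> + 1"
  have s: "0 < s" "b \<le> s - 1"
    unfolding s_def by linarith+
  define t where "t = - a / s"
  have "t * a + t\<^sup>2 * b \<le> t * a + t\<^sup>2 * (s - 1)"
    using s(2) by (simp add: mult_left_mono)
  also have "\<dots> = - a\<^sup>2 / s\<^sup>2"
    using s(1) unfolding t_def by (simp add: field_simps power2_eq_square)
  also have "\<dots> < 0"
    using \<open>a \<noteq> 0\<close> s(1) by simp
  finally show False
    using assms[of t] by simp
qed

lemma self_adjoint_psd_kernel:
  fixes A :: "'a::real_inner \<Rightarrow> 'a"
  assumes lin: "linear A" and sa: "self_adjoint A"
    and V: "subspace V" "A ` V \<subseteq> V" and psd: "\<And>z. z \<in> V \<Longrightarrow> 0 \<le> z \<bullet> A z"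
    and v: "v \<in> V" "v \<bullet> A v = 0"
  shows "A v = 0"
proof -
  let ?w = "A v"
  have "0 \<le> t * (2 * (?w \<bullet> ?w)) + t\<^sup>2 * (?w \<bullet> A ?w)" for t
  proof -
    have "v + t *\<^sub>R ?w \<in> V"
      using V v by (auto intro: subspace_add subspace_scale)
    then have "0 \<le> (v + t *\<^sub>R ?w) \<bullet> A (v + t *\<^sub>R ?w)"
      by (rule psd)
    also have "\<dots> = t * (2 * (?w \<bullet> ?w)) + t\<^sup>2 * (?w \<bullet> A ?w)"
      using sa v(2) unfolding self_adjoint_def
      by (simp add: linear_add[OF lin] linear_scale[OF lin] inner_add_left inner_add_right
          power2_eq_square algebra_simps)
    finally show ?thesis .
  qed
  then have "2 * (?w \<bullet> ?w) = 0"
    by (rule nonneg_quadratic_imp_linear_coeff_zero)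
  then show ?thesis
    by simp
qed

lemma quadratic_form_min_on_unit_sphere:
  fixes A :: "'a::euclidean_space \<Rightarrow> 'a"
  assumes lin: "linear A" and V: "subspace V" "V \<noteq> {0}"
  obtains v where "v \<in> V" "norm v = 1" "\<And>y. y \<in> V \<Longrightarrow> (v \<bullet> A v) * (norm y)\<^sup>2 \<le> y \<bullet> A y"
proof -
  define K where "K = sphere 0 1 \<inter> V"
  have compact: "compact K"
    unfolding K_def by (intro compact_Int_closed compact_sphere closed_subspace V)
  have normalize: "y /\<^sub>R norm y \<in> K" if "y \<in> V" "y \<noteq> 0" for y
    using that V unfolding K_def by (simp add: subspace_scale)
  then have nonempty: "K \<noteq> {}"
    using V subspace_0 by blast
  have "continuous_on K A"
    using lin by (simp add: linear_continuous_on linear_conv_bounded_linear)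
  then have cont: "continuous_on K (\<lambda>y. y \<bullet> A y)"
    by (intro continuous_on_inner continuous_on_id)
  obtain v where vK: "v \<in> K" and vmin: "\<And>y. y \<in> K \<Longrightarrow> v \<bullet> A v \<le> y \<bullet> A y"
    using continuous_attains_inf[OF compact nonempty cont] by blast
  have "(v \<bullet> A v) * (norm y)\<^sup>2 \<le> y \<bullet> A y" if "y \<in> V" for y
  proof (cases "y = 0")
    case True
    then show ?thesis using lin by (simp add: linear_0)
  next
    case False
    have "v \<bullet> A v \<le> (y /\<^sub>R norm y) \<bullet> A (y /\<^sub>R norm y)"
      using normalize[OF that False] by (rule vmin)
    also have "\<dots> = (y \<bullet> A y) / (norm y)\<^sup>2"
      by (simp add: linear_scale[OF lin] power2_eq_square divide_inverse mult.commute)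
    finally show ?thesis
      using False by (simp add: pos_le_divide_eq)
  qed
  moreover have "v \<in> V" "norm v = 1"
    using vK unfolding K_def by auto
  ultimately show ?thesis
    using that by blast
qed

lemma self_adjoint_invariant_subspace_eigenvector:
  fixes A :: "'a::euclidean_space \<Rightarrow> 'a"
  assumes lin: "linear A" and sa: "self_adjoint A"
    and V: "subspace V" "A ` V \<subseteq> V" "V \<noteq> {0}"
  obtains v where "v \<in> V" "norm v = 1" "A v = (v \<bullet> A v) *\<^sub>R v"
proof -
  obtain v where vV: "v \<in> V" and nv: "norm v = 1"
    and bound: "\<And>y. y \<in> V \<Longrightarrow> (v \<bullet> A v) * (norm y)\<^sup>2 \<le> y \<bullet> A y"
    using quadratic_form_min_on_unit_sphere[OF lin V(1,3)] by blast
  define c where "c = v \<bullet> A v"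
  \<comment> \<open>Shifting by the minimum c makes the form nonnegative on V and zero at the minimiser v.\<close>
  define B where "B z = A z - c *\<^sub>R z" for z
  have "linear B"
    unfolding B_def by (rule linearI) (simp_all add: linear_add[OF lin] linear_scale[OF lin] algebra_simps)
  moreover have "self_adjoint B"
    using sa unfolding self_adjoint_def B_def by (simp add: inner_diff_left inner_diff_right)
  moreover have "B ` V \<subseteq> V"
    using V unfolding B_def by (auto intro: subspace_diff subspace_scale)
  moreover have "0 \<le> z \<bullet> B z" if "z \<in> V" for z
    using bound[OF that] unfolding B_def c_def by (simp add: inner_diff_right power2_norm_eq_inner)
  moreover have "v \<bullet> B v = 0"
    unfolding B_def c_def using nv by (simp add: inner_diff_right power2_norm_eq_inner[symmetric])
  ultimately have "B v = 0"
    using self_adjoint_psd_kernel V(1) vV by metis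
  then have "A v = c *\<^sub>R v"
    unfolding B_def by simp
  with vV nv show ?thesis
    unfolding c_def by (rule that)
qed

lemma span_insert_unit_orthogonal_slice:
  fixes V :: "'a::real_inner set"
  assumes V: "subspace V" "v \<in> V" "norm v = 1" and C: "span C = {z\<in>V. z \<bullet> v = 0}"
  shows "span (insert v C) = V"
proof
  have "C \<subseteq> V"
    using C span_superset by blast
  then show "span (insert v C) \<subseteq> V"
    using V by (simp add: span_minimal)
next
  show "V \<subseteq> span (insert v C)"
  proof
    fix z assume "z \<in> V"
    then have "z - (z \<bullet> v) *\<^sub>R v \<in> span C"
      using V unfolding C by (auto simp: subspace_diff subspace_scale inner_diff_left dot_square_norm)
    then show "z \<in> span (insert v C)"
      using span_breakdown_eq by blast
  qed
qed

lemma self_adjoint_invariant_subspace_eigenbasis: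
  fixes A :: "'a::euclidean_space \<Rightarrow> 'a"
  assumes lin: "linear A" and sa: "self_adjoint A"
  shows "subspace V \<Longrightarrow> A ` V \<subseteq> V \<Longrightarrow> \<exists>B\<subseteq>V. finite B \<and> pairwise orthogonal B \<and>
     (\<forall>b\<in>B. norm b = 1 \<and> A b = (b \<bullet> A b) *\<^sub>R b) \<and> span B = V"
proof (induction "dim V" arbitrary: V rule: less_induct)
  case less
  show ?case
  proof (cases "V = {0}")
    case True
    then show ?thesis by (intro exI[of _ "{}"]) auto
  next
    case False
    obtain v where vV: "v \<in> V" and nv: "norm v = 1" and Av: "A v = (v \<bullet> A v) *\<^sub>R v"
      using self_adjoint_invariant_subspace_eigenvector[OF lin sa less.prems False] by blast
    define W where "W = {z\<in>V. z \<bullet> v = 0}"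
    have W: "subspace W"
      using less.prems(1) unfolding W_def subspace_def by (auto simp: inner_add_left)
    have "A z \<in> W" if "z \<in> W" for z
    proof -
      have "A z \<bullet> v = (v \<bullet> A v) * (z \<bullet> v)"
        using sa Av unfolding self_adjoint_def by (metis inner_scaleR_right)
      then show ?thesis
        using that less.prems(2) unfolding W_def by auto
    qed
    then have AW: "A ` W \<subseteq> W" by blast
    have "v \<notin> W"
      using nv unfolding W_def by (simp add: dot_square_norm)
    then have "W \<subset> V"
      using vV unfolding W_def by blast
    then have "dim W < dim V"
      using W less.prems(1) by (simp add: dim_psubset span_eq_iff[THEN iffD2])
    then obtain C where C: "C \<subseteq> W" "finite C" "pairwise orthogonal C"
        "\<forall>b\<in>C. norm b = 1 \<and> A b = (b \<bullet> A b) *\<^sub>R b" "span C = W"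
      using less.hyps[OF _ W AW] by blast
    have "pairwise orthogonal (insert v C)"
      using C(1,3) unfolding pairwise_insert W_def by (auto simp: orthogonal_def inner_commute)
    moreover have "span (insert v C) = V"
      using span_insert_unit_orthogonal_slice[OF less.prems(1) vV nv] C(5) unfolding W_def by blast
    ultimately show ?thesis
      using C(1,2,4) vV nv Av unfolding W_def by (intro exI[of _ "insert v C"]) auto
  qed
qed

theorem self_adjoint_orthonormal_eigenbasis:
  fixes A :: "'a::euclidean_space \<Rightarrow> 'a"
  assumes "linear A" "self_adjoint A"
  obtains B where "orthonormal_eigenbasis A B"
  using self_adjoint_invariant_subspace_eigenbasis[OF assms subspace_UNIV]
  unfolding orthonormal_eigenbasis_def orthonormal_basis_def by blast

lemma orthonormal_eigenbasis_eigenvalue: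
  assumes sa: "self_adjoint A" and B: "orthonormal_eigenbasis A B"
    and v: "v \<noteq> 0" "A v = c *\<^sub>R v"
  obtains b where "b \<in> B" "c = b \<bullet> A b"
proof -
  obtain b where b: "b \<in> B" "v \<bullet> b \<noteq> 0"
    using orthonormal_basis_nonzero[OF orthonormal_eigenbasisD(1)[OF B] v(1)] .
  have "c * (v \<bullet> b) = A v \<bullet> b"
    using v(2) by simp
  also have "\<dots> = v \<bullet> A b"
    using sa unfolding self_adjoint_def by blast
  also have "\<dots> = (b \<bullet> A b) * (v \<bullet> b)"
    using orthonormal_eigenbasisD(3)[OF B b(1)] by (metis inner_scaleR_right)
  finally show ?thesis
    using that b by simp
qed

lemma finite_eigenvalues:
  fixes A :: "'a::euclidean_space \<Rightarrow> 'a"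
  assumes "linear A" "self_adjoint A"
  shows "finite {c. \<exists>v. v \<noteq> 0 \<and> A v = c *\<^sub>R v}"
proof -
  obtain B where B: "orthonormal_eigenbasis A B"
    using self_adjoint_orthonormal_eigenbasis[OF assms] .
  have "{c. \<exists>v. v \<noteq> 0 \<and> A v = c *\<^sub>R v} \<subseteq> (\<lambda>b. b \<bullet> A b) ` B"
    using orthonormal_eigenbasis_eigenvalue[OF assms(2) B] by blast
  moreover have "finite B"
    using orthonormal_eigenbasisD(1)[OF B] unfolding orthonormal_basis_def by simp
  ultimately show ?thesis
    using finite_subset by blast
qed

lemma lambda_min_le_eigenvalue:
  fixes A :: "'a::euclidean_space \<Rightarrow> 'a"
  assumes "linear A" "self_adjoint A" "v \<noteq> 0" "A v = c *\<^sub>R v"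
  shows "lambda_min A \<le> c"
  unfolding lambda_min_def using assms finite_eigenvalues[OF assms(1,2)] by (intro Min_le) auto

lemma lambda_min_le_quadratic_form:
  fixes A :: "'a::euclidean_space \<Rightarrow> 'a"
  assumes "linear A" "self_adjoint A"
  shows "lambda_min A * (norm y)\<^sup>2 \<le> y \<bullet> A y"
proof -
  obtain B where B: "orthonormal_eigenbasis A B"
    using self_adjoint_orthonormal_eigenbasis[OF assms] .
  note ON = orthonormal_eigenbasisD(1)[OF B]
  have le: "lambda_min A \<le> b \<bullet> A b" if "b \<in> B" for b
    using lambda_min_le_eigenvalue[OF assms orthonormal_eigenbasisD(2,3)[OF B that]] .
  have "lambda_min A * (norm y)\<^sup>2 = (\<Sum>b\<in>B. lambda_min A * (y \<bullet> b)\<^sup>2)"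
    by (simp add: orthonormal_basis_norm[OF ON] sum_distrib_left)
  also have "\<dots> \<le> (\<Sum>b\<in>B. (b \<bullet> A b) * (y \<bullet> b)\<^sup>2)"
    using le by (intro sum_mono mult_right_mono) auto
  also have "\<dots> = y \<bullet> A y"
    by (subst (2) orthonormal_eigenbasis_diag_op[OF assms(1) B]) (simp add: inner_diag_op_self[OF ON])
  finally show ?thesis .
qed

lemma lambda_min_pos_le:
  fixes L :: "real^'m::finite^'m"
  assumes "transpose L = L" "v \<noteq> 0" "L *v v = c *\<^sub>R v" "c \<noteq> 0"
  shows "lambda_min_pos L \<le> c"
proof -
  have "self_adjoint ((*v) L)"
    using assms(1) by (simp add: self_adjoint_matrix_iff)
  then have "finite {c. \<exists>v. v \<noteq> 0 \<and> L *v v = c *\<^sub>R v}"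
    by (rule finite_eigenvalues[OF matrix_vector_mul_linear])
  then have "finite {c. c \<noteq> 0 \<and> (\<exists>v. v \<noteq> 0 \<and> L *v v = c *\<^sub>R v)}"
    by (rule finite_subset[rotated]) blast
  moreover have "c \<in> {c. c \<noteq> 0 \<and> (\<exists>v. v \<noteq> 0 \<and> L *v v = c *\<^sub>R v)}"
    using assms(2-4) by blast
  ultimately show ?thesis
    unfolding lambda_min_pos_def by (rule Min_le)
qed

lemma lambda_min_pos_gt_0:
  fixes L :: "real^'m::finite^'m"
  assumes sym: "transpose L = L" and psd: "\<And>x. 0 \<le> x \<bullet> (L *v x)" and "L \<noteq> 0"
  shows "0 < lambda_min_pos L"
proof -
  let ?C = "{c. c \<noteq> 0 \<and> (\<exists>v. v \<noteq> 0 \<and> L *v v = c *\<^sub>R v)}"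
  have sa: "self_adjoint ((*v) L)"
    using sym by (simp add: self_adjoint_matrix_iff)
  have "finite ?C"
    by (rule finite_subset[OF _ finite_eigenvalues[OF matrix_vector_mul_linear sa]]) blast
  moreover have "?C \<noteq> {}"
  proof
    assume "?C = {}"
    obtain B where B: "orthonormal_eigenbasis ((*v) L) B"
      using self_adjoint_orthonormal_eigenbasis[OF matrix_vector_mul_linear sa] .
    have "b \<bullet> (L *v b) = 0" if "b \<in> B" for b
      using orthonormal_eigenbasisD(2,3)[OF B that] \<open>?C = {}\<close> by blast
    then have "L *v y = 0" for y
      by (subst fun_cong[OF orthonormal_eigenbasis_diag_op[OF matrix_vector_mul_linear B]])
        (simp add: diag_op_def)
    with \<open>L \<noteq> 0\<close> show False
      by (simp add: matrix_eq)
  qed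
  moreover have "0 < c" if c: "c \<in> ?C" for c
  proof -
    obtain v where v: "v \<noteq> 0" "L *v v = c *\<^sub>R v" "c \<noteq> 0"
      using c by blast
    have "0 \<le> c * (v \<bullet> v)"
      using psd[of v] v(2) by simp
    moreover have "0 < v \<bullet> v"
      using v(1) by simp
    ultimately have "0 \<le> c"
      by (simp add: zero_le_mult_iff)
    then show ?thesis
      using v(3) by simp
  qed
  ultimately show ?thesis
    unfolding lambda_min_pos_def by simp
qed

section \<open>Square roots of positive semidefinite matrices\<close>

lemma eigenvalue_diff_psd_square_roots:
  fixes S T :: "real^'m::finite^'m"
  assumes S: "transpose S = S" "\<And>x. 0 \<le> x \<bullet> (S *v x)"
    and T: "transpose T = T" "\<And>x. 0 \<le> x \<bullet> (T *v x)"
    and sq: "S ** S = T ** T" and b: "b \<noteq> 0" "(S - T) *v b = d *\<^sub>R b"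
  shows "d = 0"
proof (rule ccontr)
  assume "d \<noteq> 0"
  define D where "D = S - T"
  have saS: "self_adjoint ((*v) S)" and saT: "self_adjoint ((*v) T)"
    using S(1) T(1) unfolding self_adjoint_matrix_iff by auto
  then have saD: "self_adjoint ((*v) D)"
    unfolding D_def self_adjoint_def
    by (simp add: matrix_vector_mult_diff_rdistrib inner_diff_left inner_diff_right)
  have Db: "D *v b = d *\<^sub>R b"
    unfolding D_def by (rule b(2))
  have "S *v (S *v b) - T *v (T *v b) = S *v (D *v b) + D *v (T *v b)"
    unfolding D_def by (simp add: matrix_vector_mult_diff_rdistrib matrix_vector_mult_diff_distrib)
  moreover have "S *v (S *v b) = T *v (T *v b)"
    using sq by (simp add: matrix_vector_mul_assoc)
  ultimately have "0 = b \<bullet> (S *v (D *v b)) + (D *v b) \<bullet> (T *v b)"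
    using saD unfolding self_adjoint_def by (metis inner_add_right inner_zero_right right_minus_eq)
  then have "d * (b \<bullet> (S *v b) + b \<bullet> (T *v b)) = 0"
    by (simp add: Db matrix_vector_mult_scaleR algebra_simps)
  with \<open>d \<noteq> 0\<close> have "b \<bullet> (S *v b) + b \<bullet> (T *v b) = 0"
    by simp
  then have "b \<bullet> (S *v b) = 0" "b \<bullet> (T *v b) = 0"
    using S(2)[of b] T(2)[of b] by linarith+
  then have "S *v b = 0" "T *v b = 0"
    using self_adjoint_psd_kernel[OF matrix_vector_mul_linear _ subspace_UNIV] saS saT S(2) T(2)
    by blast+
  then have "d *\<^sub>R b = 0"
    using Db unfolding D_def by (simp add: matrix_vector_mult_diff_rdistrib)
  with \<open>d \<noteq> 0\<close> b(1) show False
    by simp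
qed

lemma psd_sqrt_unique:
  fixes S T :: "real^'m::finite^'m"
  assumes S: "transpose S = S" "\<And>x. 0 \<le> x \<bullet> (S *v x)"
    and T: "transpose T = T" "\<And>x. 0 \<le> x \<bullet> (T *v x)"
    and sq: "S ** S = T ** T"
  shows "S = T"
proof -
  have "self_adjoint ((*v) (S - T))"
    using S(1) T(1) unfolding self_adjoint_matrix_iff[symmetric] self_adjoint_def
    by (simp add: matrix_vector_mult_diff_rdistrib inner_diff_left inner_diff_right)
  then obtain B where B: "orthonormal_eigenbasis ((*v) (S - T)) B"
    using self_adjoint_orthonormal_eigenbasis[OF matrix_vector_mul_linear] by blast
  have "b \<bullet> ((S - T) *v b) = 0" if "b \<in> B" for b
    using eigenvalue_diff_psd_square_roots[OF S T sq orthonormal_eigenbasisD(2,3)[OF B that]] .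
  then have "(S - T) *v y = 0" for y
    using fun_cong[OF orthonormal_eigenbasis_diag_op[OF matrix_vector_mul_linear B], of y]
    by (simp add: diag_op_def)
  then show ?thesis
    by (simp add: matrix_eq matrix_vector_mult_diff_rdistrib)
qed

lemma psd_sqrt_eigenbasis:
  fixes L :: "real^'m::finite^'m"
  assumes psd: "\<And>x. 0 \<le> x \<bullet> (L *v x)" and B: "orthonormal_eigenbasis ((*v) L) B"
  shows "(*v) (psd_sqrt L) = diag_op B (\<lambda>b. sqrt (b \<bullet> (L *v b)))"
proof -
  define R where "R = diag_op B (\<lambda>b. sqrt (b \<bullet> (L *v b)))"
  define S where "S = matrix R"
  note ON = orthonormal_eigenbasisD(1)[OF B]
  have SR: "(*v) S = R"
    unfolding S_def R_def by (intro ext matrix_works) (simp add: linear_matrix_vector_mul_eq linear_diag_op)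
  have "self_adjoint ((*v) S)"
    unfolding SR R_def by (rule self_adjoint_diag_op)
  have spec: "transpose S = S \<and> (\<forall>x. 0 \<le> x \<bullet> (S *v x)) \<and> S ** S = L"
  proof (intro conjI allI)
    show "transpose S = S"
      using \<open>self_adjoint ((*v) S)\<close> by (simp add: self_adjoint_matrix_iff)
    show "0 \<le> x \<bullet> (S *v x)" for x
      using psd unfolding SR R_def inner_diag_op_self[OF ON] by (intro sum_nonneg) auto
    have "(S ** S) *v y = L *v y" for y
      using orthonormal_eigenbasis_diag_op[OF matrix_vector_mul_linear B] psd
      by (simp add: SR R_def diag_op_diag_op[OF ON] flip: matrix_vector_mul_assoc)
    then show "S ** S = L"
      by (simp add: matrix_eq)
  qed
  have "psd_sqrt L = S"
    unfolding psd_sqrt_def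
  proof (rule the_equality)
    show "transpose S = S \<and> (\<forall>x. 0 \<le> x \<bullet> (S *v x)) \<and> S ** S = L"
      by (fact spec)
    show "T = S" if "transpose T = T \<and> (\<forall>x. 0 \<le> x \<bullet> (T *v x)) \<and> T ** T = L" for T
      using that spec psd_sqrt_unique[of T S] by simp
  qed
  then show ?thesis
    using SR R_def by simp
qed

lemma psd_sqrt_symmetric:
  fixes L :: "real^'m::finite^'m"
  assumes "transpose L = L" "\<And>x. 0 \<le> x \<bullet> (L *v x)"
  shows "transpose (psd_sqrt L) = psd_sqrt L"
proof -
  obtain B where B: "orthonormal_eigenbasis ((*v) L) B"
    using self_adjoint_orthonormal_eigenbasis[OF matrix_vector_mul_linear] assms(1)
    by (metis self_adjoint_matrix_iff)
  show ?thesis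
    unfolding self_adjoint_matrix_iff[symmetric] psd_sqrt_eigenbasis[OF assms(2) B]
    by (rule self_adjoint_diag_op)
qed

lemma psd_sqrt_mult_self:
  fixes L :: "real^'m::finite^'m"
  assumes "transpose L = L" "\<And>x. 0 \<le> x \<bullet> (L *v x)"
  shows "psd_sqrt L *v (psd_sqrt L *v x) = L *v x"
proof -
  obtain B where B: "orthonormal_eigenbasis ((*v) L) B"
    using self_adjoint_orthonormal_eigenbasis[OF matrix_vector_mul_linear] assms(1)
    by (metis self_adjoint_matrix_iff)
  have "L *v x = diag_op B (\<lambda>b. b \<bullet> (L *v b)) x"
    using orthonormal_eigenbasis_diag_op[OF matrix_vector_mul_linear B] by (rule fun_cong)
  then show ?thesis
    using assms(2) fun_cong[OF psd_sqrt_eigenbasis[OF assms(2) B]]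
    by (simp add: diag_op_diag_op[OF orthonormal_eigenbasisD(1)[OF B]])
qed

lemma psd_sqrt_kernel:
  fixes S :: "'a::real_inner \<Rightarrow> 'a"
  assumes "self_adjoint S" "S (S x) = L x" "L x = 0"
  shows "S x = 0"
proof -
  have "S x \<bullet> S x = x \<bullet> S (S x)"
    using assms(1) unfolding self_adjoint_def by blast
  then show ?thesis
    using assms(2,3) by simp
qed

lemma diag_op_sqrt_preimage:
  assumes ON: "orthonormal_basis B" and nonneg: "\<And>b. b \<in> B \<Longrightarrow> 0 \<le> \<mu> b"
    and kernel: "\<And>b. b \<in> B \<Longrightarrow> \<mu> b = 0 \<Longrightarrow> c \<bullet> b = 0"
    and gap: "\<And>b. b \<in> B \<Longrightarrow> \<mu> b \<noteq> 0 \<Longrightarrow> l \<le> \<mu> b" and "0 < l"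
  obtains y where "diag_op B (\<lambda>b. sqrt (\<mu> b)) y = c" "l * (norm y)\<^sup>2 \<le> (norm c)\<^sup>2"
proof
  define \<nu> where "\<nu> b = (if \<mu> b = 0 then 0 else 1 / sqrt (\<mu> b))" for b
  define y where "y = diag_op B \<nu> c"
  have coeff: "sqrt (\<mu> b) * \<nu> b * (c \<bullet> b) = c \<bullet> b" if "b \<in> B" for b
    using kernel[OF that] nonneg[OF that] unfolding \<nu>_def by auto
  have "diag_op B (\<lambda>b. sqrt (\<mu> b)) y = diag_op B (\<lambda>b. sqrt (\<mu> b) * \<nu> b) c"
    unfolding y_def by (rule diag_op_diag_op[OF ON])
  also have "\<dots> = (\<Sum>b\<in>B. (c \<bullet> b) *\<^sub>R b)"
    unfolding diag_op_def by (intro sum.cong refl) (simp add: coeff)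
  finally have "diag_op B (\<lambda>b. sqrt (\<mu> b)) y = (\<Sum>b\<in>B. (c \<bullet> b) *\<^sub>R b)" .
  then show "diag_op B (\<lambda>b. sqrt (\<mu> b)) y = c"
    using orthonormal_basis_expansion[OF ON, of c] by simp
  have "l * (\<nu> b * (c \<bullet> b))\<^sup>2 \<le> (c \<bullet> b)\<^sup>2" if "b \<in> B" for b
  proof (cases "\<mu> b = 0")
    case False
    then have "0 < \<mu> b" "l \<le> \<mu> b"
      using nonneg[OF that] gap[OF that] by auto
    then have "l * (\<nu> b)\<^sup>2 \<le> 1"
      unfolding \<nu>_def using False by (simp add: power_divide)
    then show ?thesis
      using mult_right_mono[of "l * (\<nu> b)\<^sup>2" 1 "(c \<bullet> b)\<^sup>2"] by (simp add: power_mult_distrib mult.assoc)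
  qed (simp add: \<nu>_def)
  then have "(\<Sum>b\<in>B. l * (y \<bullet> b)\<^sup>2) \<le> (\<Sum>b\<in>B. (c \<bullet> b)\<^sup>2)"
    unfolding y_def by (intro sum_mono) (simp add: inner_diag_op[OF ON])
  then show "l * (norm y)\<^sup>2 \<le> (norm c)\<^sup>2"
    by (simp add: orthonormal_basis_norm[OF ON] sum_distrib_left)
qed

section \<open>Graph Laplacians\<close>

lemma connected_graphD:
  assumes "connected_graph E"
  shows "symp E" "irreflp E" "E\<^sup>*\<^sup>* i j"
  using assms unfolding connected_graph_def symp_def irreflp_def by auto

lemma laplacian_symmetric:
  assumes "symp E"
  shows "transpose (laplacian E) = laplacian E"
  using assms unfolding laplacian_def transpose_def symp_def by (auto simp: vec_eq_iff)

lemma laplacian_mult: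
  fixes x :: "real^'m::finite"
  assumes "irreflp E"
  shows "(laplacian E *v x) $ i = (\<Sum>j\<in>UNIV. if E i j then x $ i - x $ j else 0)"
proof -
  have filter: "(\<Sum>j\<in>UNIV. if E i j then f j else 0) = (\<Sum>j\<in>{k. E i k}. f j)" for f :: "'m \<Rightarrow> real"
    by (simp add: sum.If_cases Collect_conj_eq)
  have "(laplacian E *v x) $ i
      = (\<Sum>j\<in>UNIV. (if j = i then real (card {k. E i k}) * x $ i else 0) - (if E i j then x $ j else 0))"
    using assms unfolding laplacian_def matrix_vector_mult_def irreflp_def
    by (auto intro!: sum.cong)
  also have "\<dots> = real (card {k. E i k}) * x $ i - (\<Sum>j\<in>{k. E i k}. x $ j)"
    by (simp add: sum_subtractf filter)
  also have "\<dots> = (\<Sum>j\<in>{k. E i k}. x $ i - x $ j)"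
    by (simp add: sum_subtractf)
  finally show ?thesis
    by (simp add: filter)
qed

lemma laplacian_quadratic_form:
  fixes x :: "real^'m::finite"
  assumes "symp E" "irreflp E"
  shows "2 * (x \<bullet> (laplacian E *v x)) = (\<Sum>i\<in>UNIV. \<Sum>j\<in>UNIV. if E i j then (x $ i - x $ j)\<^sup>2 else 0)"
proof -
  have symE: "E i j = E j i" for i j
    using assms(1) by (meson sympD)
  define P where "P = (\<Sum>i\<in>UNIV. \<Sum>j\<in>UNIV. if E i j then x $ i * (x $ i - x $ j) else 0)"
  have "x \<bullet> (laplacian E *v x) = P"
    unfolding P_def inner_vec_def laplacian_mult[OF assms(2)]
    by (simp add: sum_distrib_left if_distrib cong: if_cong)
  moreover have "P = (\<Sum>i\<in>UNIV. \<Sum>j\<in>UNIV. if E i j then x $ j * (x $ j - x $ i) else 0)"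
    unfolding P_def by (subst sum.swap) (simp add: symE)
  ultimately have "2 * (x \<bullet> (laplacian E *v x))
      = (\<Sum>i\<in>UNIV. \<Sum>j\<in>UNIV. (if E i j then x $ i * (x $ i - x $ j) else 0)
          + (if E i j then x $ j * (x $ j - x $ i) else 0))"
    unfolding P_def by (simp add: sum.distrib)
  also have "\<dots> = (\<Sum>i\<in>UNIV. \<Sum>j\<in>UNIV. if E i j then (x $ i - x $ j)\<^sup>2 else 0)"
    by (intro sum.cong refl) (simp add: power2_eq_square algebra_simps)
  finally show ?thesis .
qed

lemma laplacian_psd:
  fixes x :: "real^'m::finite"
  assumes "symp E" "irreflp E"
  shows "0 \<le> x \<bullet> (laplacian E *v x)"
proof -
  have "0 \<le> (\<Sum>i\<in>UNIV. \<Sum>j\<in>UNIV. if E i j then (x $ i - x $ j)\<^sup>2 else (0::real))"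
    by (intro sum_nonneg) auto
  then show ?thesis
    unfolding laplacian_quadratic_form[OF assms, symmetric] by simp
qed

lemma laplacian_kernel_const:
  fixes u :: "real^'m::finite"
  assumes "connected_graph E" and "laplacian E *v u = 0"
  shows "u $ i = u $ j"
proof -
  have "(\<Sum>i\<in>UNIV. \<Sum>j\<in>UNIV. if E i j then (u $ i - u $ j)\<^sup>2 else (0::real)) = 0"
    using laplacian_quadratic_form[OF connected_graphD(1,2)[OF assms(1)], of u] assms(2) by simp
  then have "\<forall>a b. (if E a b then (u $ a - u $ b)\<^sup>2 else 0) = (0::real)"
    by (simp add: sum_nonneg_eq_0_iff sum_nonneg)
  then have edge: "u $ a = u $ b" if "E a b" for a b
    using that by (metis power_zero_numeral power_eq_0_iff right_minus_eq)
  have "E\<^sup>*\<^sup>* i j"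
    using assms(1) by (rule connected_graphD(3))
  then show ?thesis
    by (induction rule: rtranclp_induct) (auto dest: edge)
qed

lemma laplacian_ones:
  assumes "irreflp E"
  shows "laplacian E *v (\<chi> i. 1) = 0"
  by (simp add: vec_eq_iff laplacian_mult[OF assms] cong: if_cong)

lemma laplacian_nonzero:
  fixes E :: "'m::finite \<Rightarrow> 'm \<Rightarrow> bool"
  assumes "connected_graph E" and "2 \<le> CARD('m)"
  shows "laplacian E \<noteq> 0"
proof -
  have "\<not> CARD('m) \<le> Suc 0"
    using assms(2) by simp
  then obtain i j :: 'm where "i \<noteq> j"
    by (auto simp: card_le_Suc0_iff_eq)
  have "E\<^sup>*\<^sup>* i j"
    using assms(1) by (rule connected_graphD(3))
  then have "\<exists>k. E i k"
    using \<open>i \<noteq> j\<close> by (induction rule: converse_rtranclp_induct) auto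
  then obtain k where "E i k" ..
  then have "laplacian E $ i $ i \<noteq> 0"
    unfolding laplacian_def by (auto simp: card_gt_0_iff)
  then show ?thesis
    by auto
qed

lemma connected_graph_laplacian:
  assumes "connected_graph E"
  shows "transpose (laplacian E) = laplacian E" "0 \<le> x \<bullet> (laplacian E *v x)"
    "laplacian E *v (\<chi> i. 1) = 0"
  using laplacian_symmetric laplacian_psd laplacian_ones connected_graphD[OF assms] by blast+

lemma lambda_min_pos_laplacian_gt_0:
  fixes E :: "'m::finite \<Rightarrow> 'm \<Rightarrow> bool"
  assumes "connected_graph E" "2 \<le> CARD('m)"
  shows "0 < lambda_min_pos (laplacian E)"
  using lambda_min_pos_gt_0[OF connected_graph_laplacian(1,2)[OF assms(1)] laplacian_nonzero[OF assms]] .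

lemma psd_sqrt_laplacian:
  assumes "connected_graph E"
  shows "transpose (psd_sqrt (laplacian E)) = psd_sqrt (laplacian E)"
    and "psd_sqrt (laplacian E) *v (\<chi> i. 1) = 0"
proof -
  note L = connected_graph_laplacian[OF assms]
  show S: "transpose (psd_sqrt (laplacian E)) = psd_sqrt (laplacian E)"
    by (rule psd_sqrt_symmetric[OF L(1,2)])
  show "psd_sqrt (laplacian E) *v (\<chi> i. 1) = 0"
    using S L(3) psd_sqrt_mult_self[OF L(1,2)]
    by (intro psd_sqrt_kernel[where S="(*v) (psd_sqrt (laplacian E))" and L="(*v) (laplacian E)"])
      (simp_all add: self_adjoint_matrix_iff)
qed

lemma laplacian_sqrt_preimage:
  fixes E :: "'m::finite \<Rightarrow> 'm \<Rightarrow> bool" and c :: "real^'m"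
  assumes graph: "connected_graph E" and "2 \<le> CARD('m)" and sum0: "(\<Sum>i\<in>UNIV. c $ i) = 0"
  shows "\<exists>z. psd_sqrt (laplacian E) *v z = c \<and>
    lambda_min_pos (laplacian E) * (norm z)\<^sup>2 \<le> (norm c)\<^sup>2"
proof -
  define L where "L = laplacian E"
  have sym: "transpose L = L" and psd: "\<And>x. 0 \<le> x \<bullet> (L *v x)"
    unfolding L_def using connected_graph_laplacian[OF graph] by blast+
  obtain B where B: "orthonormal_eigenbasis ((*v) L) B"
    using self_adjoint_orthonormal_eigenbasis[OF matrix_vector_mul_linear] sym
    by (metis self_adjoint_matrix_iff)
  note ON = orthonormal_eigenbasisD(1)[OF B]
  have "c \<bullet> b = 0" if b: "b \<in> B" "b \<bullet> (L *v b) = 0" for b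
  proof -
    have "L *v b = 0"
      using orthonormal_eigenbasisD(3)[OF B b(1)] b(2) by simp
    then have const: "b $ i = b $ undefined" for i
      unfolding L_def using laplacian_kernel_const[OF graph] by blast
    have "c \<bullet> b = (\<Sum>i\<in>UNIV. c $ i * b $ undefined)"
      unfolding inner_vec_def by (intro sum.cong refl) (metis const inner_real_def)
    then show ?thesis
      using sum0 by (simp flip: sum_distrib_right)
  qed
  moreover have "lambda_min_pos L \<le> b \<bullet> (L *v b)" if "b \<in> B" "b \<bullet> (L *v b) \<noteq> 0" for b
    using lambda_min_pos_le[OF sym orthonormal_eigenbasisD(2,3)[OF B that(1)] that(2)] .
  moreover have "0 < lambda_min_pos L"
    unfolding L_def by (rule lambda_min_pos_laplacian_gt_0[OF assms(1,2)])
  ultimately obtain z where z: "diag_op B (\<lambda>b. sqrt (b \<bullet> (L *v b))) z = c"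
      "lambda_min_pos L * (norm z)\<^sup>2 \<le> (norm c)\<^sup>2"
    using diag_op_sqrt_preimage[OF ON, where \<mu>="\<lambda>b. b \<bullet> (L *v b)" and c=c and l="lambda_min_pos L"] psd
    by blast
  moreover have "psd_sqrt L *v z = diag_op B (\<lambda>b. sqrt (b \<bullet> (L *v b))) z"
    using psd_sqrt_eigenbasis[OF psd B] by (rule fun_cong)
  ultimately show ?thesis
    unfolding L_def by auto
qed

section \<open>Block vectors and the Kronecker product\<close>

definition block_col :: "'n \<Rightarrow> real^'n^'m \<Rightarrow> real^'m" where
  "block_col k y = (\<chi> i. y $ i $ k)"

lemma block_col_kron_I: "block_col k (kron_I A y) = A *v block_col k y"
  by (simp add: block_col_def kron_I_def matrix_vector_mult_def vec_eq_iff sum_component mult.commute)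

lemma block_col_eqI:
  assumes "\<And>k. block_col k y = block_col k z"
  shows "y = z"
  using assms unfolding block_col_def by (simp add: vec_eq_iff)

lemma inner_block_col: "y \<bullet> z = (\<Sum>k\<in>UNIV. block_col k y \<bullet> block_col k z)"
  unfolding inner_vec_def block_col_def by (subst sum.swap) simp

lemma norm_block_col: "(norm y)\<^sup>2 = (\<Sum>k\<in>UNIV. (norm (block_col k y))\<^sup>2)"
  by (simp add: power2_norm_eq_inner inner_block_col[of y y])

lemma block_sum_block_col: "block_sum y $ k = (\<Sum>i\<in>UNIV. block_col k y $ i)"
  by (simp add: block_sum_def block_col_def sum_component)

lemma linear_kron_I: "linear (kron_I A)"
  by (rule linearI)
    (simp_all add: kron_I_def vec_eq_iff scaleR_add_right sum.distrib scaleR_sum_right mult_ac)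

lemma self_adjoint_kron_I:
  assumes "transpose A = A"
  shows "self_adjoint (kron_I A)"
proof -
  have "self_adjoint ((*v) A)"
    using assms by (simp add: self_adjoint_matrix_iff)
  then show ?thesis
    unfolding self_adjoint_def by (simp add: inner_block_col[of "kron_I A _"] inner_block_col[of _ "kron_I A _"] block_col_kron_I)
qed

lemma block_sum_kron_I:
  assumes "transpose A = A" "A *v (\<chi> i. 1) = 0"
  shows "block_sum (kron_I A y) = 0"
proof -
  have sa: "self_adjoint ((*v) A)"
    using assms(1) by (simp add: self_adjoint_matrix_iff)
  have "block_sum (kron_I A y) $ k = 0" for k
  proof -
    have "block_sum (kron_I A y) $ k = (\<Sum>i\<in>UNIV. (A *v block_col k y) $ i)"
      by (simp only: block_sum_block_col block_col_kron_I)
    also have "\<dots> = (\<chi> i. 1) \<bullet> (A *v block_col k y)"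
      by (simp add: inner_vec_def)
    also have "\<dots> = (A *v (\<chi> i. 1)) \<bullet> block_col k y"
      using sa unfolding self_adjoint_def by simp
    finally show ?thesis
      using assms(2) by simp
  qed
  then show ?thesis
    by (simp add: vec_eq_iff)
qed

lemma kron_I_const:
  assumes "A *v (\<chi> i. 1) = 0"
  shows "kron_I A (\<chi> i. w) = 0"
proof -
  have "(\<Sum>j\<in>UNIV. A $ i $ j) = 0" for i
    using assms by (simp add: vec_eq_iff matrix_vector_mult_def)
  then show ?thesis
    by (simp add: kron_I_def vec_eq_iff flip: scaleR_sum_left)
qed

lemma kron_I_preimage:
  fixes A :: "real^'m::finite^'m" and d :: "real^'n::finite^'m"
  assumes "\<And>k. \<exists>z. A *v z = block_col k d \<and> l * (norm z)\<^sup>2 \<le> (norm (block_col k d))\<^sup>2"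
  obtains y where "kron_I A y = d" "l * (norm y)\<^sup>2 \<le> (norm d)\<^sup>2"
proof -
  have "\<forall>k. \<exists>z. A *v z = block_col k d \<and> l * (norm z)\<^sup>2 \<le> (norm (block_col k d))\<^sup>2"
    using assms by blast
  from choice[OF this] obtain z
    where z: "\<forall>k. A *v z k = block_col k d \<and> l * (norm (z k))\<^sup>2 \<le> (norm (block_col k d))\<^sup>2"
    by blast
  define y :: "real^'n^'m" where "y = (\<chi> i k. z k $ i)"
  have col: "block_col k y = z k" for k
    by (simp add: y_def block_col_def vec_eq_iff)
  have "kron_I A y = d"
    by (rule block_col_eqI) (simp add: block_col_kron_I col z)
  moreover have "l * (norm y)\<^sup>2 \<le> (norm d)\<^sup>2"
    unfolding norm_block_col[of y] norm_block_col[of d] sum_distrib_left col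
    using z by (intro sum_mono) blast
  ultimately show ?thesis
    by (rule that)
qed

lemma kron_sqrt_laplacian_preimage:
  fixes E :: "'m::finite \<Rightarrow> 'm \<Rightarrow> bool" and d :: "real^'n::finite^'m"
  assumes "connected_graph E" "2 \<le> CARD('m)" "block_sum d = 0"
  obtains y where "kron_I (psd_sqrt (laplacian E)) y = d"
    "lambda_min_pos (laplacian E) * (norm y)\<^sup>2 \<le> (norm d)\<^sup>2"
proof (rule kron_I_preimage)
  show "\<exists>z. psd_sqrt (laplacian E) *v z = block_col k d \<and>
      lambda_min_pos (laplacian E) * (norm z)\<^sup>2 \<le> (norm (block_col k d))\<^sup>2" for k
    using assms(3) by (intro laplacian_sqrt_preimage[OF assms(1,2)]) (simp add: vec_eq_iff block_sum_block_col)
qed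

section \<open>Gradients and Hessians\<close>

lemma grad_eqI:
  fixes F :: "'a::real_inner \<Rightarrow> real"
  assumes "(F has_derivative (\<lambda>h. g \<bullet> h)) (at x)"
  shows "grad F x = g"
proof -
  have "(F has_derivative (\<lambda>h. grad F x \<bullet> h)) (at x)"
    using assms unfolding grad_def by (rule someI)
  then have "(\<lambda>h. grad F x \<bullet> h) = (\<lambda>h. g \<bullet> h)"
    using assms by (rule has_derivative_unique)
  then show ?thesis
    by (metis vector_eq_rdot inner_commute)
qed

lemma has_derivative_grad:
  fixes f :: "'a::euclidean_space \<Rightarrow> real"
  assumes "f differentiable (at x)"
  shows "(f has_derivative (\<lambda>h. grad f x \<bullet> h)) (at x)"
proof -
  obtain D where D: "(f has_derivative D) (at x)"
    using assms unfolding differentiable_def by blast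
  then have "linear D"
    by (simp add: has_derivative_linear)
  then have "D = (\<lambda>h. adjoint D 1 \<bullet> h)"
    by (simp add: adjoint_clauses(2))
  then have "\<exists>g. (f has_derivative (\<lambda>h. g \<bullet> h)) (at x)"
    using D by metis
  then show ?thesis
    unfolding grad_def by (rule someI_ex)
qed

lemma grad_inner_Basis:
  fixes f :: "'a::euclidean_space \<Rightarrow> real"
  assumes "f differentiable (at x)"
  shows "grad f x \<bullet> b = frechet_derivative f (at x) b"
  using frechet_derivative_at[OF has_derivative_grad[OF assms]] by simp

lemma smooth_fun_differentiable:
  assumes "smooth_fun f"
  shows "f differentiable (at x)"
  using assms unfolding smooth_fun_def by blast

lemma smooth_fun_partial:
  assumes "smooth_fun f" "b \<in> Basis"
  shows "smooth_fun (\<lambda>x. frechet_derivative f (at x) b)"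
  using assms unfolding smooth_fun_def by blast

lemma smooth_fun_grad_differentiable:
  fixes f :: "'a::euclidean_space \<Rightarrow> real"
  assumes "smooth_fun f"
  shows "grad f differentiable (at x)"
proof -
  have "grad f = (\<lambda>z. \<Sum>b\<in>Basis. frechet_derivative f (at z) b *\<^sub>R b)"
    using grad_inner_Basis[OF smooth_fun_differentiable[OF assms]]
    by (metis (no_types, lifting) euclidean_representation sum.cong)
  moreover have "(\<lambda>z. \<Sum>b\<in>Basis. frechet_derivative f (at z) b *\<^sub>R b) differentiable (at x)"
    using smooth_fun_differentiable[OF smooth_fun_partial[OF assms]]
    by (intro differentiable_sum differentiable_scaleR differentiable_const) auto
  ultimately show ?thesis
    by simp
qed

lemma norm_scaleR_add_le:
  fixes h k :: "'a::real_normed_vector"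
  assumes "\<bar>s\<bar> \<le> t" "\<bar>\<xi>\<bar> \<le> t"
  shows "norm (s *\<^sub>R k + \<xi> *\<^sub>R h) \<le> t * (norm h + norm k)"
proof -
  have "norm (s *\<^sub>R k + \<xi> *\<^sub>R h) \<le> \<bar>s\<bar> * norm k + \<bar>\<xi>\<bar> * norm h"
    using norm_triangle_ineq[of "s *\<^sub>R k" "\<xi> *\<^sub>R h"] by simp
  also have "\<dots> \<le> t * norm k + t * norm h"
    using assms by (intro add_mono mult_right_mono) auto
  finally show ?thesis
    by (simp add: algebra_simps)
qed

definition second_difference :: "('a::real_vector \<Rightarrow> real) \<Rightarrow> 'a \<Rightarrow> 'a \<Rightarrow> 'a \<Rightarrow> real \<Rightarrow> real" where
  "second_difference f x h k t = f (x + t *\<^sub>R h + t *\<^sub>R k) - f (x + t *\<^sub>R h) - f (x + t *\<^sub>R k) + f x"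

lemma second_difference_commute: "second_difference f x h k t = second_difference f x k h t"
  unfolding second_difference_def by (simp add: algebra_simps)

lemma second_difference_mean_value:
  fixes f :: "'a::real_inner \<Rightarrow> real"
  assumes df: "\<And>z. (f has_derivative (\<lambda>v. g z \<bullet> v)) (at z)" and "0 < t"
  obtains \<xi> where "0 < \<xi>" "\<xi> < t"
    "second_difference f x h k t = t * ((g (x + t *\<^sub>R k + \<xi> *\<^sub>R h) - g (x + \<xi> *\<^sub>R h)) \<bullet> h)"
proof -
  have line: "((\<lambda>s. f (p + s *\<^sub>R h)) has_real_derivative g (p + s *\<^sub>R h) \<bullet> h) (at s)" for p s
  proof -
    have "((\<lambda>s. f (p + s *\<^sub>R h)) has_derivative (\<lambda>ds. g (p + s *\<^sub>R h) \<bullet> (ds *\<^sub>R h))) (at s)"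
      by (rule has_derivative_compose[OF _ df]) (auto intro!: derivative_eq_intros)
    moreover have "(\<lambda>ds. g (p + s *\<^sub>R h) \<bullet> (ds *\<^sub>R h)) = (*) (g (p + s *\<^sub>R h) \<bullet> h)"
      by (simp add: fun_eq_iff mult.commute)
    ultimately show ?thesis
      by (simp add: has_field_derivative_def)
  qed
  define \<psi> where "\<psi> s = f ((x + t *\<^sub>R k) + s *\<^sub>R h) - f (x + s *\<^sub>R h)" for s
  define \<psi>' where "\<psi>' s = (g (x + t *\<^sub>R k + s *\<^sub>R h) - g (x + s *\<^sub>R h)) \<bullet> h" for s
  have "(\<psi> has_real_derivative \<psi>' s) (at s)" for s
    unfolding \<psi>_def \<psi>'_def inner_diff_left by (intro DERIV_diff line)
  then obtain \<xi> where "0 < \<xi>" "\<xi> < t" and mvt: "\<psi> t - \<psi> 0 = (t - 0) * \<psi>' \<xi>"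
    using MVT2[of 0 t \<psi> \<psi>'] \<open>0 < t\<close> by blast
  moreover have "\<psi> t - \<psi> 0 = second_difference f x h k t"
    unfolding \<psi>_def second_difference_def by (simp add: algebra_simps)
  ultimately show ?thesis
    using that unfolding \<psi>'_def by simp
qed

lemma second_difference_remainder:
  fixes f :: "'a::real_inner \<Rightarrow> real"
  assumes df: "\<And>z. (f has_derivative (\<lambda>v. g z \<bullet> v)) (at z)" and linH: "linear H" and "0 < t"
  obtains \<xi> where "0 < \<xi>" "\<xi> < t"
    "\<bar>second_difference f x h k t - t\<^sup>2 * (H k \<bullet> h)\<bar>
       \<le> t * ((norm (g (x + (t *\<^sub>R k + \<xi> *\<^sub>R h)) - g x - H (t *\<^sub>R k + \<xi> *\<^sub>R h))
              + norm (g (x + \<xi> *\<^sub>R h) - g x - H (\<xi> *\<^sub>R h))) * norm h)"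
proof -
  obtain \<xi> where \<xi>: "0 < \<xi>" "\<xi> < t" and mv:
    "second_difference f x h k t = t * ((g (x + t *\<^sub>R k + \<xi> *\<^sub>R h) - g (x + \<xi> *\<^sub>R h)) \<bullet> h)"
    by (rule second_difference_mean_value[OF df \<open>0 < t\<close>])
  define r1 where "r1 = g (x + (t *\<^sub>R k + \<xi> *\<^sub>R h)) - g x - H (t *\<^sub>R k + \<xi> *\<^sub>R h)"
  define r2 where "r2 = g (x + \<xi> *\<^sub>R h) - g x - H (\<xi> *\<^sub>R h)"
  have "g (x + t *\<^sub>R k + \<xi> *\<^sub>R h) - g (x + \<xi> *\<^sub>R h) = r1 - r2 + t *\<^sub>R H k"
    unfolding r1_def r2_def by (simp add: add.assoc linear_add[OF linH] linear_scale[OF linH])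
  then have "(g (x + t *\<^sub>R k + \<xi> *\<^sub>R h) - g (x + \<xi> *\<^sub>R h)) \<bullet> h = (r1 - r2) \<bullet> h + t * (H k \<bullet> h)"
    by (simp only: inner_add_left inner_scaleR_left)
  then have "second_difference f x h k t - t\<^sup>2 * (H k \<bullet> h)
      = t * ((r1 - r2) \<bullet> h)"
    unfolding mv by (simp add: power2_eq_square distrib_left)
  then have "\<bar>second_difference f x h k t - t\<^sup>2 * (H k \<bullet> h)\<bar>
      = t * \<bar>(r1 - r2) \<bullet> h\<bar>"
    using \<open>0 < t\<close> by (simp add: abs_mult)
  also have "\<dots> \<le> t * ((norm r1 + norm r2) * norm h)"
    using \<open>0 < t\<close> Cauchy_Schwarz_ineq2 norm_triangle_ineq4
    by (smt (verit, ccfv_SIG) mult_left_mono mult_right_mono norm_ge_zero)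
  finally show ?thesis
    using that \<xi> unfolding r1_def r2_def by blast
qed

lemma second_difference_estimate:
  fixes f :: "'a::real_inner \<Rightarrow> real"
  assumes df: "\<And>z. (f has_derivative (\<lambda>v. g z \<bullet> v)) (at z)"
    and dg: "(g has_derivative H) (at x)" and "0 < e"
  obtains d where "0 < d" "\<And>t. 0 < t \<Longrightarrow> t < d \<Longrightarrow>
    \<bar>second_difference f x h k t - t\<^sup>2 * (H k \<bullet> h)\<bar> \<le> e * t\<^sup>2"
proof -
  define M where "M = norm h + norm k + 1"
  have M: "0 < M" "norm h \<le> M" "norm h + norm k \<le> M"
    unfolding M_def using norm_ge_zero[of h] norm_ge_zero[of k] by linarith+
  define e' where "e' = e / (2 * M\<^sup>2)"
  have "0 < e'"
    unfolding e'_def using \<open>0 < e\<close> M by simp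
  then obtain d where "0 < d" and d: "\<And>y. norm (y - x) < d \<Longrightarrow> norm (g y - g x - H (y - x)) \<le> e' * norm (y - x)"
    using dg unfolding has_derivative_at_alt by blast
  have r: "norm (g (x + z) - g x - H z) \<le> e' * (t * M)" if "norm z \<le> t * M" "t * M < d" for z t
    using d[of "x + z"] that \<open>0 < e'\<close> by (smt (verit, best) add_diff_cancel_left' mult_left_mono)
  show ?thesis
  proof (rule that[of "d / M"])
    show "0 < d / M"
      using \<open>0 < d\<close> M by simp
    fix t assume t: "0 < t" "t < d / M"
    then have tM: "t * M < d"
      using M by (simp add: field_simps)
    obtain \<xi> where \<xi>: "0 < \<xi>" "\<xi> < t" and bound:
      "\<bar>second_difference f x h k t - t\<^sup>2 * (H k \<bullet> h)\<bar>
         \<le> t * ((norm (g (x + (t *\<^sub>R k + \<xi> *\<^sub>R h)) - g x - H (t *\<^sub>R k + \<xi> *\<^sub>R h))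
                + norm (g (x + \<xi> *\<^sub>R h) - g x - H (\<xi> *\<^sub>R h))) * norm h)"
      using second_difference_remainder[OF df has_derivative_linear[OF dg] t(1)] by blast
    have tM': "t * (norm h + norm k) \<le> t * M"
      using t(1) M(3) by (simp add: mult_left_mono)
    have "norm (t *\<^sub>R k + \<xi> *\<^sub>R h) \<le> t * M"
      using order_trans[OF norm_scaleR_add_le[of t t \<xi> k h] tM'] t(1) \<xi> by simp
    moreover have "norm (\<xi> *\<^sub>R h) \<le> t * M"
      using order_trans[OF norm_scaleR_add_le[of 0 t \<xi> k h] tM'] t(1) \<xi> by simp
    ultimately have "norm (g (x + (t *\<^sub>R k + \<xi> *\<^sub>R h)) - g x - H (t *\<^sub>R k + \<xi> *\<^sub>R h)) \<le> e' * (t * M)"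
        "norm (g (x + \<xi> *\<^sub>R h) - g x - H (\<xi> *\<^sub>R h)) \<le> e' * (t * M)"
      using r tM by blast+
    then have "t * ((norm (g (x + (t *\<^sub>R k + \<xi> *\<^sub>R h)) - g x - H (t *\<^sub>R k + \<xi> *\<^sub>R h))
                + norm (g (x + \<xi> *\<^sub>R h) - g x - H (\<xi> *\<^sub>R h))) * norm h)
        \<le> t * ((e' * (t * M) + e' * (t * M)) * M)"
      using M t(1) \<open>0 < e'\<close> by (intro mult_left_mono mult_mono add_mono) auto
    also have "\<dots> = e * t\<^sup>2"
      unfolding e'_def using M by (simp add: field_simps power2_eq_square)
    finally show "\<bar>second_difference f x h k t - t\<^sup>2 * (H k \<bullet> h)\<bar> \<le> e * t\<^sup>2"
      using bound by linarith
  qed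
qed

lemma second_difference_tendsto:
  fixes f :: "'a::real_inner \<Rightarrow> real"
  assumes df: "\<And>z. (f has_derivative (\<lambda>v. g z \<bullet> v)) (at z)" and dg: "(g has_derivative H) (at x)"
  shows "((\<lambda>t. second_difference f x h k t / t\<^sup>2)
           \<longlongrightarrow> H k \<bullet> h) (at_right 0)"
proof (rule tendstoI)
  fix e :: real assume "0 < e"
  then have "0 < e / 2" by simp
  then obtain d where "0 < d" and d: "\<And>t. 0 < t \<Longrightarrow> t < d \<Longrightarrow>
      \<bar>second_difference f x h k t - t\<^sup>2 * (H k \<bullet> h)\<bar> \<le> e / 2 * t\<^sup>2"
    using second_difference_estimate[OF df dg] by metis
  have "dist (second_difference f x h k t / t\<^sup>2) (H k \<bullet> h) < e"
    if "0 < t" "t < d" for t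
  proof -
    have "dist (second_difference f x h k t / t\<^sup>2) (H k \<bullet> h)
        = \<bar>second_difference f x h k t - t\<^sup>2 * (H k \<bullet> h)\<bar> / t\<^sup>2"
      using that by (simp add: dist_real_def field_simps)
    also have "\<dots> \<le> e / 2"
      using d[OF that] that by (simp add: divide_le_eq)
    finally show ?thesis
      using \<open>0 < e\<close> by linarith
  qed
  then show "\<forall>\<^sub>F t in at_right 0. dist (second_difference f x h k t / t\<^sup>2) (H k \<bullet> h) < e"
    unfolding eventually_at_right_field using \<open>0 < d\<close> by (intro exI[of _ d]) auto
qed

lemma derivative_of_gradient_symmetric:
  fixes f :: "'a::real_inner \<Rightarrow> real"
  assumes df: "\<And>z. (f has_derivative (\<lambda>v. g z \<bullet> v)) (at z)" and dg: "(g has_derivative H) (at x)"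
  shows "H k \<bullet> h = H h \<bullet> k"
proof -
  have "((\<lambda>t. second_difference f x h k t / t\<^sup>2)
           \<longlongrightarrow> H h \<bullet> k) (at_right 0)"
    using second_difference_tendsto[OF df dg, of k h] by (simp only: second_difference_commute[of f x k h])
  with second_difference_tendsto[OF df dg, of h k] show ?thesis
    by (rule tendsto_unique[rotated]) simp
qed

lemma self_adjoint_hess:
  fixes F :: "'a::euclidean_space \<Rightarrow> real"
  assumes "\<And>z. F differentiable (at z)" "grad F differentiable (at x)"
  shows "self_adjoint (hess F x)"
  unfolding self_adjoint_def hess_def
  using derivative_of_gradient_symmetric[OF has_derivative_grad[OF assms(1)]
      frechet_derivative_works[THEN iffD1, OF assms(2)]]
  by (metis inner_commute)

lemma linear_hess:
  assumes "grad F differentiable (at x)"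
  shows "linear (hess F x)"
  unfolding hess_def by (rule linear_frechet_derivative[OF assms])

lemma has_derivative_vec_lambda:
  fixes f :: "'a::real_normed_vector \<Rightarrow> 'b::real_normed_vector^'m::finite"
  assumes "\<And>i. ((\<lambda>x. f x $ i) has_derivative (\<lambda>h. f' h $ i)) (at x)" and "bounded_linear f'"
  shows "(f has_derivative f') (at x)"
proof -
  have "((\<lambda>y. (1 / norm (y - x)) *\<^sub>R (f y $ i - (f x $ i + f' (y - x) $ i))) \<longlongrightarrow> 0) (at x)" for i
    using assms(1)[of i] unfolding has_derivative_within by blast
  then have "((\<lambda>y. (1 / norm (y - x)) *\<^sub>R (f y - (f x + f' (y - x)))) \<longlongrightarrow> 0) (at x)"
    by (intro vec_tendstoI) simp
  then show ?thesis
    using assms(2) unfolding has_derivative_within by blast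
qed

lemma has_derivative_separable_sum:
  fixes f :: "'m::finite \<Rightarrow> 'a::euclidean_space \<Rightarrow> real"
  assumes "\<And>i. f i differentiable (at (\<theta> $ i))"
  shows "((\<lambda>\<theta>. \<Sum>i\<in>UNIV. f i (\<theta> $ i)) has_derivative (\<lambda>h. (\<chi> i. grad (f i) (\<theta> $ i)) \<bullet> h)) (at \<theta>)"
proof -
  have "((\<lambda>\<theta>. \<Sum>i\<in>UNIV. f i (\<theta> $ i)) has_derivative (\<lambda>h. \<Sum>i\<in>UNIV. grad (f i) (\<theta> $ i) \<bullet> h $ i)) (at \<theta>)"
    by (intro has_derivative_sum has_derivative_compose[OF bounded_linear_imp_has_derivative[OF bounded_linear_vec_nth]]
        has_derivative_grad assms)
  then show ?thesis
    by (simp add: inner_vec_def)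
qed

lemma grad_separable_sum:
  fixes f :: "'m::finite \<Rightarrow> 'a::euclidean_space \<Rightarrow> real"
  assumes "\<And>i. f i differentiable (at (\<theta> $ i))"
  shows "grad (\<lambda>\<theta>. \<Sum>i\<in>UNIV. f i (\<theta> $ i)) \<theta> = (\<chi> i. grad (f i) (\<theta> $ i))"
  by (rule grad_eqI[OF has_derivative_separable_sum[OF assms]])

lemma grad_separable_sum_differentiable:
  fixes f :: "'m::finite \<Rightarrow> 'a::euclidean_space \<Rightarrow> real"
  assumes "\<And>i z. f i differentiable (at z)" "\<And>i. grad (f i) differentiable (at (\<theta> $ i))"
  shows "grad (\<lambda>\<theta>. \<Sum>i\<in>UNIV. f i (\<theta> $ i)) differentiable (at \<theta>)"
proof -
  define D where "D i = frechet_derivative (grad (f i)) (at (\<theta> $ i))" for i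
  have dD: "(grad (f i) has_derivative D i) (at (\<theta> $ i))" for i
    unfolding D_def using assms(2) by (simp add: frechet_derivative_works)
  have linD: "linear (D i)" for i
    using dD by (rule has_derivative_linear)
  have "linear (\<lambda>h. \<chi> i. D i (h $ i))"
    by (rule linearI) (simp_all add: vec_eq_iff linear_add[OF linD] linear_scale[OF linD])
  then have "((\<lambda>\<theta>. \<chi> i. grad (f i) (\<theta> $ i)) has_derivative (\<lambda>h. \<chi> i. D i (h $ i))) (at \<theta>)"
    by (intro has_derivative_vec_lambda)
      (simp_all add: linear_conv_bounded_linear
        has_derivative_compose[OF bounded_linear_imp_has_derivative[OF bounded_linear_vec_nth] dD])
  moreover have "grad (\<lambda>\<theta>. \<Sum>i\<in>UNIV. f i (\<theta> $ i)) = (\<lambda>\<theta>. \<chi> i. grad (f i) (\<theta> $ i))"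
    using grad_separable_sum assms(1) by blast
  ultimately show ?thesis
    unfolding differentiable_def by auto
qed

lemma separable_sum_smooth:
  fixes f :: "'m::finite \<Rightarrow> 'a::euclidean_space \<Rightarrow> real"
  assumes "\<forall>i. smooth_fun (f i)"
  shows "(\<lambda>\<theta>. \<Sum>i\<in>UNIV. f i (\<theta> $ i)) differentiable (at \<theta>)"
    and "grad (\<lambda>\<theta>. \<Sum>i\<in>UNIV. f i (\<theta> $ i)) differentiable (at \<theta>)"
proof -
  have fi: "f i differentiable (at z)" "grad (f i) differentiable (at z)" for i z
    using assms smooth_fun_differentiable smooth_fun_grad_differentiable by blast+
  show "(\<lambda>\<theta>. \<Sum>i\<in>UNIV. f i (\<theta> $ i)) differentiable (at \<theta>)"
    using has_derivative_separable_sum[OF fi(1)] by (rule differentiableI)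
  show "grad (\<lambda>\<theta>. \<Sum>i\<in>UNIV. f i (\<theta> $ i)) differentiable (at \<theta>)"
    by (rule grad_separable_sum_differentiable[OF fi])
qed

lemma has_derivative_affine:
  fixes K :: "'a::euclidean_space \<Rightarrow> 'b::real_normed_vector"
  assumes "linear K"
  shows "((\<lambda>y. \<theta>0 + K y) has_derivative K) (at y)"
proof -
  have "((\<lambda>y. \<theta>0 + K y) has_derivative (\<lambda>h. 0 + K h)) (at y)"
    using assms by (intro has_derivative_add has_derivative_const bounded_linear_imp_has_derivative)
      (simp add: linear_conv_bounded_linear)
  then show ?thesis
    by simp
qed

lemma grad_affine_comp:
  fixes F :: "'a::euclidean_space \<Rightarrow> real"
  assumes "F differentiable (at (\<theta>0 + K y))" "linear K" "self_adjoint K"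
  shows "grad (\<lambda>y. F (\<theta>0 + K y)) y = K (grad F (\<theta>0 + K y))"
proof (rule grad_eqI)
  have "((\<lambda>y. F (\<theta>0 + K y)) has_derivative (\<lambda>h. grad F (\<theta>0 + K y) \<bullet> K h)) (at y)"
    by (rule has_derivative_compose[OF has_derivative_affine[OF assms(2)] has_derivative_grad[OF assms(1)]])
  moreover have "grad F (\<theta>0 + K y) \<bullet> K h = K (grad F (\<theta>0 + K y)) \<bullet> h" for h
    using assms(3) unfolding self_adjoint_def by simp
  ultimately show "((\<lambda>y. F (\<theta>0 + K y)) has_derivative (\<lambda>h. K (grad F (\<theta>0 + K y)) \<bullet> h)) (at y)"
    by simp
qed

lemma hess_affine_comp:
  fixes F :: "'a::euclidean_space \<Rightarrow> real"
  assumes "\<And>z. F differentiable (at z)" "grad F differentiable (at (\<theta>0 + K x))" "linear K" "self_adjoint K"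
  shows "hess (\<lambda>y. F (\<theta>0 + K y)) x = (\<lambda>h. K (hess F (\<theta>0 + K x) (K h)))"
proof -
  have "grad (\<lambda>y. F (\<theta>0 + K y)) = (\<lambda>y. K (grad F (\<theta>0 + K y)))"
    using grad_affine_comp assms(1,3,4) by blast
  moreover have "((\<lambda>y. K (grad F (\<theta>0 + K y))) has_derivative (\<lambda>h. K (hess F (\<theta>0 + K x) (K h)))) (at x)"
  proof -
    have "((\<lambda>y. \<theta>0 + K y) has_derivative K) (at x)"
      by (rule has_derivative_affine[OF assms(3)])
    moreover have "(grad F has_derivative hess F (\<theta>0 + K x)) (at (\<theta>0 + K x))"
      unfolding hess_def using assms(2) by (simp add: frechet_derivative_works)
    moreover have "(K has_derivative K) (at y)" for y
      using assms(3) by (simp add: bounded_linear_imp_has_derivative linear_conv_bounded_linear)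
    ultimately show ?thesis
      by (metis (no_types) has_derivative_compose)
  qed
  ultimately show ?thesis
    unfolding hess_def by (simp add: frechet_derivative_at[symmetric])
qed

lemma hess_lower_bound_transfer:
  fixes K H :: "'a::euclidean_space \<Rightarrow> 'a"
  assumes K: "linear K" "self_adjoint K" and H: "linear H" "self_adjoint H"
    and kernel: "K v = 0" "v \<noteq> 0"
    and lmin: "- \<gamma> \<le> lambda_min (\<lambda>h. K (H (K h)))"
    and pre: "K y = d" "l * (norm y)\<^sup>2 \<le> (norm d)\<^sup>2" "0 < l"
  shows "- (\<gamma> / l) * (norm d)\<^sup>2 \<le> d \<bullet> H d"
proof -
  let ?A = "\<lambda>h. K (H (K h))"
  have linA: "linear ?A"
    using linear_compose[OF linear_compose[OF K(1) H(1)] K(1)] by (simp add: o_def)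
  have saA: "self_adjoint ?A"
    using K(2) H(2) unfolding self_adjoint_def by simp
  have "?A v = 0 *\<^sub>R v"
    using kernel(1) K(1) H(1) by (simp add: linear_0)
  then have "lambda_min ?A \<le> 0"
    by (rule lambda_min_le_eigenvalue[OF linA saA kernel(2)])
  then have "0 \<le> \<gamma>"
    using lmin by simp
  have "- (\<gamma> / l) * (norm d)\<^sup>2 \<le> - \<gamma> * (norm y)\<^sup>2"
    using pre(2,3) \<open>0 \<le> \<gamma>\<close> by (simp add: field_simps mult_left_mono)
  also have "\<dots> \<le> lambda_min ?A * (norm y)\<^sup>2"
    using mult_right_mono[OF lmin, of "(norm y)\<^sup>2"] by simp
  also have "\<dots> \<le> y \<bullet> ?A y"
    by (rule lambda_min_le_quadratic_form[OF linA saA])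
  also have "\<dots> = d \<bullet> H d"
    using K(2) pre(1) unfolding self_adjoint_def by metis
  finally show ?thesis .
qed

theorem proposition3:
  fixes f :: "'m::finite \<Rightarrow> real^'n::finite \<Rightarrow> real"
    and E :: "'m \<Rightarrow> 'm \<Rightarrow> bool"
    and r :: "real^'n" and \<theta>0 x :: "real^'n^'m" and \<epsilon> \<gamma> :: real
  assumes m2: "CARD('m) \<ge> 2"
    and smooth: "\<forall>i. smooth_fun (f i)"
    and graph: "connected_graph E"
    and init: "block_sum \<theta>0 = r"
    and i: "norm (grad (\<lambda>y. (\<Sum>i\<in>UNIV. f i ((\<theta>0 + kron_I (psd_sqrt (laplacian E)) y) $ i))) x) \<le> \<epsilon>"
    and ii: "block_sum x = 0"
    and iii: "lambda_min (hess (\<lambda>y. (\<Sum>i\<in>UNIV. f i ((\<theta>0 + kron_I (psd_sqrt (laplacian E)) y) $ i))) x) \<ge> - \<gamma>"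
  shows "second_order_optimal (\<lambda>\<theta>. \<Sum>i\<in>UNIV. f i (\<theta> $ i)) r (laplacian E) \<epsilon>
           (\<gamma> / lambda_min_pos (laplacian E)) (\<theta>0 + kron_I (psd_sqrt (laplacian E)) x)"
proof -
  define S where "S = psd_sqrt (laplacian E)"
  define F :: "real^'n^'m \<Rightarrow> real" where "F = (\<lambda>\<theta>. \<Sum>i\<in>UNIV. f i (\<theta> $ i))"
  have S: "transpose S = S" "S *v (\<chi> i. 1) = 0"
    unfolding S_def by (rule psd_sqrt_laplacian[OF graph])+
  have K: "linear (kron_I S)" "self_adjoint (kron_I S)"
    using linear_kron_I self_adjoint_kron_I[OF S(1)] by blast+
  have dF: "F differentiable (at z)" "grad F differentiable (at z)" for z
    unfolding F_def using separable_sum_smooth[OF smooth] by blast+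
  have "norm (kron_I S (grad F (\<theta>0 + kron_I S x))) \<le> \<epsilon>"
    using i grad_affine_comp[OF dF(1) K] unfolding F_def S_def by simp
  moreover have "block_sum (\<theta>0 + kron_I S x) = r"
    using init block_sum_kron_I[OF S] by (simp add: block_sum_def sum.distrib)
  moreover have "- (\<gamma> / lambda_min_pos (laplacian E)) * (norm d)\<^sup>2 \<le> d \<bullet> hess F (\<theta>0 + kron_I S x) d"
    if d0: "block_sum d = 0" for d
  proof -
    obtain y where y: "kron_I S y = d" "lambda_min_pos (laplacian E) * (norm y)\<^sup>2 \<le> (norm d)\<^sup>2"
      using kron_sqrt_laplacian_preimage[OF graph m2 d0] unfolding S_def .
    have "- \<gamma> \<le> lambda_min (\<lambda>h. kron_I S (hess F (\<theta>0 + kron_I S x) (kron_I S h)))"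
      using iii hess_affine_comp[OF dF K, of \<theta>0 x] unfolding F_def S_def by simp
    moreover have "kron_I S (\<chi> i. \<chi> k. 1) = 0" "(\<chi> i. \<chi> k. 1 :: real^'n^'m) \<noteq> 0"
      using kron_I_const[OF S(2)] by (auto simp: vec_eq_iff)
    ultimately show ?thesis
      using hess_lower_bound_transfer[OF K linear_hess self_adjoint_hess _ _ _ y
          lambda_min_pos_laplacian_gt_0[OF graph m2]] dF
      by blast
  qed
  ultimately show ?thesis
    unfolding second_order_optimal_def F_def S_def by blast
qed

end
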